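(* Let $1\le k<N$ be integers and let $\Omega$ be a bounded convex domain in $\mathbb R^N$. Assume that $$\Omega\subset\{z=(x,y)\in\mathbb R^{N-1}\times\mathbb R: y>0\},\qquad 0=(0,0)\in\partial\Omega,$$ and that, as $(x,y)\in\partial\Omega$ and $(x,y)\to(0,0)$, $$y=o(|x|^2).$$ Let $b$ be a positive constant. Then there are no positive supersolutions $u\in\mathrm{LSC}(\Omega)$ of $$\mathcal P_k^+(D^2u)+b|Du|\le0\quad\text{in }\Omega$$ with the property $\lim_{\Omega\ni z\to0}u(z)=0$.
   Context: For a symmetric $N\times N$ matrix $X$ with ordered eigenvalues $\lambda_1(X)\le\dots\le\lambda_N(X)$, $\mathcal P_k^+(X)=\sum_{i=1}^k\lambda_{N+1-i}(X)$. A domain is a nonempty open connected set. $\mathrm{LSC}(\Omega)$ is the set of real-valued lower semicontinuous functions on $\Omega$. The inequality is in the viscosity sense: whenever $\varphi$ is $C^2$ near $x_0\in\Omega$ and $u-\varphi$ has a local minimum at $x_0$, then $\mathcal P_k^+(D^2\varphi(x_0))+b|D\varphi(x_0)|\le0$. Positive means $u>0$ in $\Omega$. *)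

theory Defs
  imports "HOL-Analysis.Analysis" "HOL-Library.Landau_Symbols" "HOL-Library.Multiset"
begin

text \<open>
  A symmetric \<open>N \<times> N\<close> matrix is represented by the self-adjoint linear map it induces on an
  \<open>N\<close>-dimensional Euclidean space. Each eigenvalue is listed as often as the dimension of
  its eigenspace; for self-adjoint maps this is also its algebraic multiplicity, so that the
  multiset below has exactly \<open>N\<close> elements.
\<close>

definition eigenvalue_mset :: "('a::euclidean_space \<Rightarrow> 'a) \<Rightarrow> real multiset" where
  "eigenvalue_mset X =
     (\<Sum>l \<in> {l. \<exists>v. v \<noteq> 0 \<and> X v = l *\<^sub>R v}. replicate_mset (dim {v. X v = l *\<^sub>R v}) l)"

text \<open>The eigenvalues in increasing order, indexed from 1 to \<open>N\<close>.\<close>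

definition ordered_eigenvalue :: "('a::euclidean_space \<Rightarrow> 'a) \<Rightarrow> nat \<Rightarrow> real" where
  "ordered_eigenvalue X i = sorted_list_of_multiset (eigenvalue_mset X) ! (i - 1)"

definition truncated_Pucci_sup :: "nat \<Rightarrow> ('a::euclidean_space \<Rightarrow> 'a) \<Rightarrow> real" where
  "truncated_Pucci_sup k X = (\<Sum>i = 1..k. ordered_eigenvalue X (DIM('a) + 1 - i))"

definition grad :: "('a::euclidean_space \<Rightarrow> real) \<Rightarrow> 'a \<Rightarrow> 'a" where
  "grad f x = (THE D. GDERIV f x :> D)"

definition hess :: "('a::euclidean_space \<Rightarrow> real) \<Rightarrow> 'a \<Rightarrow> 'a \<Rightarrow> 'a" where
  "hess f x = frechet_derivative (grad f) (at x)"

text \<open>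
  In finite dimension, continuity of \<open>x \<mapsto> hess f x v\<close> for every \<open>v\<close> is continuity of all
  second partial derivatives.
\<close>

definition C2_on :: "'a::euclidean_space set \<Rightarrow> ('a \<Rightarrow> real) \<Rightarrow> bool" where
  "C2_on U f \<longleftrightarrow> open U \<and> f differentiable_on U \<and> grad f differentiable_on U \<and>
     (\<forall>v. continuous_on U (\<lambda>x. hess f x v))"

definition lsc_on :: "'a::topological_space set \<Rightarrow> ('a \<Rightarrow> real) \<Rightarrow> bool" where
  "lsc_on S u \<longleftrightarrow> (\<forall>x\<in>S. \<forall>a<u x. \<forall>\<^sub>F z in at x within S. a < u z)"

text \<open>
  Viscosity sense of \<open>P\<^sub>k\<^sup>+(D\<^sup>2u) + b |Du| \<le> 0\<close> in the open set \<open>\<Omega>\<close>. Only the values of \<open>u\<close> on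
  \<open>\<Omega>\<close> matter.
\<close>

definition viscosity_supersolution ::
  "nat \<Rightarrow> real \<Rightarrow> 'a::euclidean_space set \<Rightarrow> ('a \<Rightarrow> real) \<Rightarrow> bool" where
  "viscosity_supersolution k b \<Omega> u \<longleftrightarrow>
     (\<forall>x\<^sub>0\<in>\<Omega>. \<forall>\<phi> U. x\<^sub>0 \<in> U \<longrightarrow> C2_on U \<phi> \<longrightarrow>
        (\<forall>\<^sub>F x in at x\<^sub>0 within \<Omega>. u x\<^sub>0 - \<phi> x\<^sub>0 \<le> u x - \<phi> x) \<longrightarrow>
        truncated_Pucci_sup k (hess \<phi> x\<^sub>0) + b * norm (grad \<phi> x\<^sub>0) \<le> 0)"

end

theory Submission
  imports Defs
begin

text \<open>
  Since \<open>\<partial>\<Omega>\<close> is flatter at \<open>0\<close> than any sphere, for every \<open>R\<close> the ball of radius \<open>R\<close> centred at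
  \<open>c = (0, R)\<close> lies in \<open>\<Omega>\<close> near \<open>0\<close>. A radial function \<open>\<phi> = g (|z - c|\<^sup>2)\<close> with \<open>g' < 0\<close> and
  \<open>g'' < 0\<close> has the \<open>N - 1\<close> tangential eigenvalues \<open>2 g'\<close> and one smaller radial eigenvalue, so that
  \<open>P\<^sub>k\<^sup>+(D\<^sup>2\<phi>) + b |D\<phi>| = 2 |g'| (b |z - c| - k)\<close> is positive where \<open>|z - c| > k / b\<close>, however
  concave \<open>g\<close> is. Let \<open>m > 0\<close> be a lower bound of \<open>u\<close> on the cap \<open>{y = r, |z - c| \<le> R}\<close>.
  Comparing \<open>u\<close> with the barriers \<open>m (1 - exp (s (|z - c|\<^sup>2 - \<rho>\<^sup>2)))\<close>, \<open>\<rho> < R\<close>, and letting \<open>s\<close> grow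
  bounds \<open>u\<close> below by \<open>m / 2\<close> on the axis arbitrarily close to \<open>0\<close>.
\<close>

section \<open>Eigenvalues of a rank-one perturbation of a multiple of the identity\<close>

text \<open>The map multiplies by \<open>\<alpha>\<close> on the hyperplane orthogonal to
  \<open>p\<close> and by another number on the line of \<open>p\<close>. A nonzero
  \<open>\<gamma>\<close> keeps the two eigenspaces apart, and dimension at least 2 makes the
  hyperplane nontrivial.\<close>

lemma eigenvalue_mset_rank_one:
  fixes p :: "'a::euclidean_space"
  assumes p: "p \<noteq> 0" and g: "\<gamma> \<noteq> 0" and N: "2 \<le> DIM('a)"
  shows "eigenvalue_mset (\<lambda>v. \<alpha> *\<^sub>R v + (\<gamma> * (p \<bullet> v)) *\<^sub>R p)
       = add_mset (\<alpha> + \<gamma> * (p \<bullet> p)) (replicate_mset (DIM('a) - 1) \<alpha>)"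
proof -
  define X where "X = (\<lambda>v. \<alpha> *\<^sub>R v + (\<gamma> * (p \<bullet> v)) *\<^sub>R p)"
  define \<beta> where "\<beta> = \<alpha> + \<gamma> * (p \<bullet> p)"
  have pp: "p \<bullet> p > 0" using p by simp
  have ab: "\<alpha> \<noteq> \<beta>" using p g by (simp add: \<beta>_def)
  have Ea: "{v. X v = \<alpha> *\<^sub>R v} = {v. p \<bullet> v = 0}"
    using p g by (auto simp: X_def)
  have da: "dim {v. X v = \<alpha> *\<^sub>R v} = DIM('a) - 1"
    unfolding Ea using p by (rule dim_hyperplane)
  \<comment> \<open>Pairing the eigenvector equation with \<open>p\<close> identifies
    \<open>l\<close>; inserting this value back shows that \<open>v\<close> is parallel to
    \<open>p\<close>.\<close>
  have eig: "v \<in> span {p} \<and> l = \<beta>" if "X v = l *\<^sub>R v" "p \<bullet> v \<noteq> 0" for v l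
  proof -
    have "p \<bullet> X v = l * (p \<bullet> v)" using that by simp
    then have "\<beta> * (p \<bullet> v) = l * (p \<bullet> v)"
      by (simp add: X_def \<beta>_def inner_right_distrib algebra_simps)
    then have l: "l = \<beta>" using that by simp
    then have "(\<gamma> * (p \<bullet> p)) *\<^sub>R v = (\<gamma> * (p \<bullet> v)) *\<^sub>R p"
      using that(1) by (simp add: X_def \<beta>_def algebra_simps)
    then have "\<gamma> *\<^sub>R ((p \<bullet> p) *\<^sub>R v) = \<gamma> *\<^sub>R ((p \<bullet> v) *\<^sub>R p)" by simp
    then have "(p \<bullet> p) *\<^sub>R v = (p \<bullet> v) *\<^sub>R p"
      using g unfolding scaleR_cancel_left by blast
    then have "v = (1 / (p \<bullet> p)) *\<^sub>R ((p \<bullet> v) *\<^sub>R p)"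
      using pp by (metis scaleR_scaleR scaleR_one nonzero_divide_eq_eq less_irrefl)
    then have "v = (1 / (p \<bullet> p) * (p \<bullet> v)) *\<^sub>R p" by simp
    then have "v \<in> span {p}" by (metis span_mul span_base insertI1)
    with l show ?thesis by simp
  qed
  have Eb: "{v. X v = \<beta> *\<^sub>R v} = span {p}"
  proof
    show "{v. X v = \<beta> *\<^sub>R v} \<subseteq> span {p}"
    proof
      fix v assume v: "v \<in> {v. X v = \<beta> *\<^sub>R v}"
      show "v \<in> span {p}"
      proof (cases "p \<bullet> v = 0")
        case True
        then have "v = 0" using v ab by (simp add: X_def)
        then show ?thesis by (simp add: span_zero)
      next
        case False
        then show ?thesis using eig v by blast
      qed
    qed
    show "span {p} \<subseteq> {v. X v = \<beta> *\<^sub>R v}"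
      by (auto simp: span_singleton X_def \<beta>_def algebra_simps)
  qed
  have db: "dim {v. X v = \<beta> *\<^sub>R v} = 1"
    unfolding Eb using p by simp
  have "{l. \<exists>v. v \<noteq> 0 \<and> X v = l *\<^sub>R v} = {\<alpha>, \<beta>}"
  proof (intro equalityI subsetI)
    fix l assume "l \<in> {l. \<exists>v. v \<noteq> 0 \<and> X v = l *\<^sub>R v}"
    then obtain v where v: "v \<noteq> 0" "X v = l *\<^sub>R v" by blast
    then show "l \<in> {\<alpha>, \<beta>}"
      using eig[of v l] by (cases "p \<bullet> v = 0") (auto simp: X_def)
  next
    have "\<not> {v. X v = \<alpha> *\<^sub>R v} \<subseteq> {0}"
      using da N by (metis dim_eq_0 diff_is_0_eq not_less_eq_eq numeral_2_eq_2 One_nat_def)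
    moreover have "X p = \<beta> *\<^sub>R p" by (simp add: X_def \<beta>_def algebra_simps)
    ultimately show "l \<in> {l. \<exists>v. v \<noteq> 0 \<and> X v = l *\<^sub>R v}" if "l \<in> {\<alpha>, \<beta>}" for l
      using that p by blast
  qed
  then have "eigenvalue_mset X = replicate_mset (DIM('a) - 1) \<alpha> + replicate_mset 1 \<beta>"
    using ab da db by (simp add: eigenvalue_mset_def)
  then show ?thesis by (simp add: X_def \<beta>_def)
qed

text \<open>A negative \<open>\<gamma>\<close> sends the eigenvalue along \<open>p\<close> to the
  bottom of the list, and \<open>k < DIM('a)\<close> leaves it out of the sum. Concavity along
  \<open>p\<close> therefore costs nothing, which is what lets the barriers be arbitrarily
  steep.\<close>

lemma truncated_Pucci_sup_rank_one:
  fixes p :: "'a::euclidean_space"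
  assumes p: "p \<noteq> 0" and g: "\<gamma> < 0" and k: "k < DIM('a)"
  shows "truncated_Pucci_sup k (\<lambda>v. \<alpha> *\<^sub>R v + (\<gamma> * (p \<bullet> v)) *\<^sub>R p) = k * \<alpha>"
proof (cases "k = 0")
  case True
  then show ?thesis by (simp add: truncated_Pucci_sup_def)
next
  case False
  define \<beta> where "\<beta> = \<alpha> + \<gamma> * (p \<bullet> p)"
  let ?X = "\<lambda>v. \<alpha> *\<^sub>R v + (\<gamma> * (p \<bullet> v)) *\<^sub>R p"
  have "\<beta> < \<alpha>" using p g by (simp add: \<beta>_def mult_neg_pos)
  then have "sorted (\<beta> # replicate (DIM('a) - 1) \<alpha>)" by auto
  moreover have "eigenvalue_mset ?X = mset (\<beta> # replicate (DIM('a) - 1) \<alpha>)"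
    using eigenvalue_mset_rank_one[of p \<gamma> \<alpha>] assms False by (simp add: \<beta>_def)
  ultimately have "sorted_list_of_multiset (eigenvalue_mset ?X) = \<beta> # replicate (DIM('a) - 1) \<alpha>"
    by (metis sorted_list_of_multiset_mset sorted_sort_id)
  \<comment> \<open>The zero-based list position is \<open>DIM('a) - i\<close>; it is at least 1
    because \<open>i \<le> k < DIM('a)\<close>, so the head \<open>\<beta>\<close> is never
    hit.\<close>
  then have "ordered_eigenvalue ?X (DIM('a) + 1 - i) = \<alpha>" if "i \<in> {1..k}" for i
    using that k by (auto simp: ordered_eigenvalue_def nth_Cons' intro!: nth_replicate)
  then show ?thesis by (simp add: truncated_Pucci_sup_def)
qed

section \<open>Radial test functions\<close>

text \<open>Using the squared distance as radial variable keeps the function smooth at the centre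
  \<open>c\<close> as well.\<close>

lemma has_derivative_radial:
  fixes c z :: "'a::euclidean_space"
  assumes "(g has_real_derivative d) (at ((z - c) \<bullet> (z - c)))"
  shows "((\<lambda>z. g ((z - c) \<bullet> (z - c))) has_derivative (\<lambda>h. 2 * d * ((z - c) \<bullet> h))) (at z)"
proof -
  have "((\<lambda>z. (z - c) \<bullet> (z - c)) has_derivative (\<lambda>h. 2 * ((z - c) \<bullet> h))) (at z)"
    by (auto intro!: derivative_eq_intros simp: inner_commute)
  then show ?thesis
    using has_derivative_compose[of _ _ z UNIV g "(*) d"] assms
    by (simp add: has_field_derivative_def mult.assoc mult.left_commute)
qed

lemma grad_eqI:
  assumes "GDERIV f x :> D"
  shows "grad f x = D"
  unfolding grad_def
proof (rule the_equality, rule assms)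
  fix D' assume "GDERIV f x :> D'"
  then have "(\<lambda>h. h \<bullet> D') = (\<lambda>h. h \<bullet> D)"
    using assms unfolding gderiv_def by (rule has_derivative_unique)
  then show "D' = D" by (metis vector_eq_ldot)
qed

context
  fixes g g' g'' :: "real \<Rightarrow> real" and c :: "'a::euclidean_space"
  assumes g: "\<And>q. (g has_real_derivative g' q) (at q)"
    and g': "\<And>q. (g' has_real_derivative g'' q) (at q)"
begin

lemma grad_radial:
  "grad (\<lambda>z. g ((z - c) \<bullet> (z - c))) = (\<lambda>z. (2 * g' ((z - c) \<bullet> (z - c))) *\<^sub>R (z - c))"
proof
  fix z
  show "grad (\<lambda>z. g ((z - c) \<bullet> (z - c))) z = (2 * g' ((z - c) \<bullet> (z - c))) *\<^sub>R (z - c)"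
    by (rule grad_eqI)
      (use has_derivative_radial[where z = z and c = c, OF g] in \<open>simp add: gderiv_def inner_commute\<close>)
qed

lemma has_derivative_grad_radial:
  "(grad (\<lambda>z. g ((z - c) \<bullet> (z - c))) has_derivative
    (\<lambda>v. (2 * g' ((z - c) \<bullet> (z - c))) *\<^sub>R v
       + (4 * g'' ((z - c) \<bullet> (z - c)) * ((z - c) \<bullet> v)) *\<^sub>R (z - c))) (at z)"
  unfolding grad_radial
  by (rule derivative_eq_intros has_derivative_radial[OF g'] refl)+
    (simp add: algebra_simps)

text \<open>This is the shape treated by \<open>truncated_Pucci_sup_rank_one\<close>, with
  \<open>p = z - c\<close>, \<open>\<alpha> = 2 g'\<close> and
  \<open>\<gamma> = 4 g''\<close>.\<close>

lemma hess_radial: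
  "hess (\<lambda>z. g ((z - c) \<bullet> (z - c))) z =
    (\<lambda>v. (2 * g' ((z - c) \<bullet> (z - c))) *\<^sub>R v
       + (4 * g'' ((z - c) \<bullet> (z - c)) * ((z - c) \<bullet> v)) *\<^sub>R (z - c))"
  unfolding hess_def using has_derivative_grad_radial by (rule frechet_derivative_at[symmetric])

lemma C2_on_radial:
  assumes "continuous_on UNIV g''"
  shows "C2_on UNIV (\<lambda>z. g ((z - c) \<bullet> (z - c)))"
proof -
  have "continuous_on UNIV g'"
    using g' by (meson DERIV_isCont continuous_at_imp_continuous_on)
  moreover have "continuous_on UNIV (\<lambda>z. (z - c) \<bullet> (z - c))"
    by (intro continuous_intros)
  ultimately have "continuous_on UNIV (\<lambda>z. g' ((z - c) \<bullet> (z - c)))"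
    and "continuous_on UNIV (\<lambda>z. g'' ((z - c) \<bullet> (z - c)))"
    using assms by (auto intro: continuous_on_compose2[of UNIV _ UNIV "\<lambda>z. (z - c) \<bullet> (z - c)"])
  then show ?thesis
    using has_derivative_radial[OF g] has_derivative_grad_radial
    by (auto simp: C2_on_def differentiable_on_def differentiable_def hess_radial
        intro!: continuous_intros)
qed

lemma Pucci_radial_pos:
  assumes "g' ((z - c) \<bullet> (z - c)) < 0" and "g'' ((z - c) \<bullet> (z - c)) < 0"
    and "k < DIM('a)" and "k < b * norm (z - c)"
  shows "truncated_Pucci_sup k (hess (\<lambda>z. g ((z - c) \<bullet> (z - c))) z)
       + b * norm (grad (\<lambda>z. g ((z - c) \<bullet> (z - c))) z) > 0"
proof -
  have "z - c \<noteq> 0" using assms(4) by auto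
  then have "truncated_Pucci_sup k (hess (\<lambda>z. g ((z - c) \<bullet> (z - c))) z)
      = k * (2 * g' ((z - c) \<bullet> (z - c)))"
    unfolding hess_radial using assms by (intro truncated_Pucci_sup_rank_one) auto
  moreover have "b * norm (grad (\<lambda>z. g ((z - c) \<bullet> (z - c))) z)
      = - 2 * g' ((z - c) \<bullet> (z - c)) * (b * norm (z - c))"
    unfolding grad_radial using assms(1) by simp
  moreover have "0 < (- 2 * g' ((z - c) \<bullet> (z - c))) * (b * norm (z - c) - k)"
    using assms by (intro mult_pos_pos[of "- 2 * _"]) auto
  ultimately show ?thesis by (simp add: right_diff_distrib mult.commute)
qed

end

section \<open>Lower semicontinuous functions\<close>

lemma lsc_on_subset: "lsc_on S u \<Longrightarrow> T \<subseteq> S \<Longrightarrow> lsc_on T u"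
  unfolding lsc_on_def by (meson at_le filter_leD subsetD)

lemma lsc_on_diff_continuous:
  assumes u: "lsc_on S u" and \<phi>: "continuous_on S \<phi>"
  shows "lsc_on S (\<lambda>x. u x - \<phi> x)"
  unfolding lsc_on_def
proof (intro ballI allI impI)
  fix x a assume x: "x \<in> S" and a: "a < u x - \<phi> x"
  define e where "e = (u x - \<phi> x - a) / 2"
  have e: "e > 0" using a by (simp add: e_def)
  have "\<forall>\<^sub>F z in at x within S. u x - e < u z"
    using u x e by (simp add: lsc_on_def)
  moreover have "\<forall>\<^sub>F z in at x within S. \<phi> z < \<phi> x + e"
    using \<phi> x e by (intro order_tendstoD(2)[of _ "\<phi> x"]) (auto simp: continuous_on_def)
  ultimately show "\<forall>\<^sub>F z in at x within S. a < u z - \<phi> z"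
    by eventually_elim (use a in \<open>simp add: e_def field_simps\<close>)
qed

text \<open>If no minimum were attained, the relatively open sets \<open>V y\<close> would cover
  \<open>K\<close>. In a finite subcover, the index point with the least value of \<open>f\<close>
  lies in none of the chosen sets.\<close>

lemma lsc_on_attains_inf:
  assumes "compact K" and "K \<noteq> {}" and f: "lsc_on K f"
  obtains x where "x \<in> K" and "\<And>y. y \<in> K \<Longrightarrow> f x \<le> f y"
proof -
  define V where "V y = {x \<in> K. f y < f x}" for y
  have V: "openin (top_of_set K) (V y)" for y
  proof (subst openin_subopen, intro ballI)
    fix x assume x: "x \<in> V y"
    then have "\<forall>\<^sub>F z in at x within K. f y < f z" using f by (simp add: lsc_on_def V_def)
    then obtain T where T: "open T" "x \<in> T" "\<forall>z\<in>T. z \<noteq> x \<longrightarrow> z \<in> K \<longrightarrow> f y < f z"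
      unfolding eventually_at_topological by blast
    have "openin (top_of_set K) (K \<inter> T)" using T(1) by blast
    then show "\<exists>T. openin (top_of_set K) T \<and> x \<in> T \<and> T \<subseteq> V y"
      using T x by (intro exI[of _ "K \<inter> T"]) (auto simp: V_def)
  qed
  have "\<exists>x\<in>K. \<forall>y\<in>K. f x \<le> f y"
  proof (rule ccontr)
    assume "\<not> ?thesis"
    then have "K \<subseteq> \<Union> (V ` K)" by (force simp: V_def not_le)
    moreover have "\<forall>U \<in> V ` K. openin (top_of_set K) U" using V by blast
    ultimately obtain D where D: "D \<subseteq> V ` K" "finite D" "K \<subseteq> \<Union> D"
      using \<open>compact K\<close> unfolding compact_eq_openin_cover by metis
    then obtain F where F: "F \<subseteq> K" "finite F" "D = V ` F"
      by (meson finite_subset_image)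
    have "F \<noteq> {}" using D F \<open>K \<noteq> {}\<close> by auto
    then obtain y where y: "y \<in> F" "\<And>z. z \<in> F \<Longrightarrow> f y \<le> f z"
      using F(2) by (metis arg_min_if_finite not_le)
    then obtain z where "z \<in> F" "f z < f y" using D F by (auto simp: V_def)
    with y(2) show False by fastforce
  qed
  then show ?thesis using that by blast
qed

section \<open>Interior balls and comparison\<close>

lemma in_cball_axis_iff:
  fixes x :: "'a::euclidean_space" and y R :: real
  assumes "R > 0"
  shows "(x, y) \<in> cball (0, R) R \<longleftrightarrow> (norm x)\<^sup>2 + y\<^sup>2 \<le> 2 * R * y"
proof -
  have "(x, y) \<in> cball (0, R) R \<longleftrightarrow> norm ((x, y) - (0, R)) \<le> R"
    by (metis mem_cball dist_commute dist_norm)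
  also have "\<dots> \<longleftrightarrow> (norm ((x, y) - (0, R)))\<^sup>2 \<le> R\<^sup>2"
    using assms by (simp add: power2_le_iff_abs_le)
  also have "\<dots> \<longleftrightarrow> (norm x)\<^sup>2 + (y - R)\<^sup>2 \<le> R\<^sup>2"
    by (simp add: norm_Pair)
  also have "\<dots> \<longleftrightarrow> (norm x)\<^sup>2 + y\<^sup>2 \<le> 2 * R * y"
    by (simp add: power2_diff algebra_simps)
  finally show ?thesis .
qed

text \<open>The low part \<open>A\<close> of the ball is convex, hence connected. It misses the
  frontier, since flatness gives \<open>4 * R * y \<le> (norm x)\<^sup>2\<close> there while the
  ball gives at most \<open>2 * R * y\<close>. It meets \<open>\<Omega>\<close> on a segment ending
  at the origin, so it lies in \<open>\<Omega>\<close>.\<close>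

lemma interior_ball_near_flat_point:
  fixes \<Omega> :: "('a::euclidean_space \<times> real) set"
  assumes op: "open \<Omega>" and ne: "\<Omega> \<noteq> {}" and cv: "convex \<Omega>"
    and pos: "\<Omega> \<subseteq> {(x, y). y > 0}"
    and fr: "(0, 0) \<in> frontier \<Omega>"
    and flat: "(\<lambda>(x, y). y) \<in> o[at (0, 0) within frontier \<Omega>](\<lambda>(x, y). (norm x)\<^sup>2)"
    and R: "R > 0"
  obtains r where "0 < r" and "r \<le> R / 2"
    and "\<And>x y. (x, y) \<in> cball (0, R) R \<Longrightarrow> 0 < y \<Longrightarrow> y \<le> r \<Longrightarrow> (x, y) \<in> \<Omega>"
proof -
  have "\<forall>\<^sub>F z in at (0, 0) within frontier \<Omega>.
      norm ((\<lambda>(x, y). y) z) \<le> 1 / (4 * R) * norm ((\<lambda>(x, y). (norm x)\<^sup>2) z)"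
    using R by (intro landau_o.smallD[OF flat]) simp
  then obtain d where d: "d > 0"
    and small: "\<And>x y. (x, y) \<in> frontier \<Omega> \<Longrightarrow> (x, y) \<noteq> (0, 0) \<Longrightarrow> norm (x, y) < d
      \<Longrightarrow> \<bar>y\<bar> \<le> 1 / (4 * R) * (norm x)\<^sup>2"
    unfolding eventually_at by (fastforce simp: dist_norm zero_prod_def)
  \<comment> \<open>The bound \<open>R / 2\<close> will keep points of height at most
    \<open>r\<close> at distance at least \<open>R / 2\<close> from the centre. The other bound
    gives points of \<open>A\<close> squared norm at most
    \<open>2 * R * r \<le> d\<^sup>2 / 2\<close>, so that \<open>small\<close> applies to
    them.\<close>
  define r where "r = min (R / 2) (d\<^sup>2 / (4 * R))"
  define A where "A = cball (0, R) R \<inter> {z::'a \<times> real. 0 < snd z \<and> snd z \<le> r}"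
  have r: "0 < r" "r \<le> R / 2" "r \<le> d\<^sup>2 / (4 * R)" using R d by (auto simp: r_def)
  have "A = cball (0, R) R \<inter> (snd -` {0<..r})" by (auto simp: A_def)
  then have "connected A"
    by (auto intro!: convex_connected convex_Int convex_linear_vimage
        bounded_linear.linear[OF bounded_linear_snd])
  moreover have "A \<inter> frontier \<Omega> = {}"
  proof (rule ccontr)
    assume "\<not> ?thesis"
    then obtain x y where xy: "(x, y) \<in> A" "(x, y) \<in> frontier \<Omega>" by auto
    then have y: "0 < y" "y \<le> r" and q: "(norm x)\<^sup>2 + y\<^sup>2 \<le> 2 * R * y"
      using in_cball_axis_iff[OF R] by (auto simp: A_def)
    have "2 * R * y \<le> 2 * R * (d\<^sup>2 / (4 * R))"
      using y r R by (intro mult_left_mono) auto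
    also have "\<dots> = d\<^sup>2 / 2" using R by simp
    also have "\<dots> < d\<^sup>2" using d by simp
    finally have "(norm (x, y))\<^sup>2 < d\<^sup>2" using q by (simp add: norm_Pair)
    then have "norm (x, y) < d" using d by (simp add: power_less_imp_less_base)
    then have "4 * R * y \<le> (norm x)\<^sup>2"
      using small[OF xy(2)] y R by (simp add: field_simps)
    with q R y have "2 * R * y + y\<^sup>2 \<le> 0" by simp
    moreover have "0 < R * y" using R y by simp
    moreover have "0 \<le> y\<^sup>2" by simp
    ultimately show False by linarith
  qed
  moreover have "A \<inter> \<Omega> \<noteq> {}"
  proof -
    obtain x1 y1 where z1: "(x1, y1) \<in> \<Omega>" using ne by auto
    then have y1: "y1 > 0" using pos by auto
    define n where "n = (norm x1)\<^sup>2 + y1\<^sup>2"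
    have n: "n > 0" using y1 by (simp add: n_def add_nonneg_pos)
    \<comment> \<open>The three bounds place the scaled point strictly inside the segment, at height
      at most \<open>r\<close>, and in the ball: divided by \<open>t\<close>, the ball condition
      reads \<open>t * n \<le> 2 * R * y1\<close>.\<close>
    define t where "t = min (1 / 2) (min (r / y1) (2 * R * y1 / n))"
    have t: "0 < t" "t < 1" "t \<le> r / y1" "t \<le> 2 * R * y1 / n"
      using r R y1 n by (auto simp: t_def)
    have "open_segment (x1, y1) (0, 0) \<subseteq> interior \<Omega>"
      using fr z1 op by (intro in_interior_closure_convex_segment[OF cv])
        (auto simp: interior_open frontier_def)
    moreover have "(t *\<^sub>R x1, t * y1) \<in> open_segment (x1, y1) (0, 0)"
      using t y1 by (auto simp: in_segment intro!: exI[of _ "1 - t"])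
    ultimately have "(t *\<^sub>R x1, t * y1) \<in> \<Omega>" using interior_subset by blast
    moreover have "(t *\<^sub>R x1, t * y1) \<in> A"
    proof -
      have "t * n \<le> 2 * R * y1" using t n by (simp add: field_simps)
      then have "t * (t * n) \<le> t * (2 * R * y1)" using t by (intro mult_left_mono) auto
      then have "(t *\<^sub>R x1, t * y1) \<in> cball (0, R) R"
        using in_cball_axis_iff[OF R, of "t *\<^sub>R x1" "t * y1"]
        by (simp add: n_def power2_eq_square algebra_simps)
      moreover have "t * y1 \<le> r" using t y1 by (simp add: field_simps)
      ultimately show ?thesis using t y1 by (simp add: A_def)
    qed
    ultimately show ?thesis by blast
  qed
  ultimately have "A \<subseteq> \<Omega>"
    using connected_Int_frontier[of A \<Omega>] by blast
  then show ?thesis using r by (intro that[of r]) (auto simp: A_def)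
qed

text \<open>If the bound failed, \<open>u - \<phi>\<close> would have a negative minimum on the
  compact set \<open>K\<close>. It cannot lie on the sphere, where
  \<open>\<phi> \<le> 0 < u\<close>, nor at height \<open>r\<close>, where
  \<open>\<phi> \<le> m \<le> u\<close>. So \<open>\<phi>\<close> is an admissible test function at
  the minimum point, contrary to \<open>Pucci_radial_pos\<close>. The argument works for every
  \<open>s > 0\<close>.\<close>

lemma supersolution_ge_barrier:
  fixes \<Omega> :: "('a::euclidean_space \<times> real) set"
  assumes u: "lsc_on \<Omega> u" "\<And>z. z \<in> \<Omega> \<Longrightarrow> u z > 0" "viscosity_supersolution k b \<Omega> u"
    and k: "k < DIM('a \<times> real)" "b > 0" "k < b * (R / 2)"
    and r: "0 < r" "r \<le> R / 2"
    and sub: "\<And>x y. (x, y) \<in> cball (0, R) R \<Longrightarrow> 0 < y \<Longrightarrow> y \<le> r \<Longrightarrow> (x, y) \<in> \<Omega>"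
    and m: "0 < m" "\<And>x. (x, r) \<in> cball (0, R) R \<Longrightarrow> m \<le> u (x, r)"
    and s: "s > 0" and \<rho>: "0 < \<rho>" "\<rho> < R"
    and z: "z \<in> cball (0, R) \<rho>" "snd z \<le> r"
  shows "m * (1 - exp (s * ((norm (z - (0, R)))\<^sup>2 - \<rho>\<^sup>2))) \<le> u z"
proof (rule ccontr)
  assume neg: "\<not> ?thesis"
  define c where "c = ((0, R) :: 'a \<times> real)"
  define g where "g = (\<lambda>q. m * (1 - exp (s * (q - \<rho>\<^sup>2))))"
  define g' where "g' = (\<lambda>q. - m * s * exp (s * (q - \<rho>\<^sup>2)))"
  define g'' where "g'' = (\<lambda>q. - m * s * s * exp (s * (q - \<rho>\<^sup>2)))"
  define \<phi> where "\<phi> = (\<lambda>z. g ((z - c) \<bullet> (z - c)))"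
  define K where "K = cball c \<rho> \<inter> {z. snd z \<le> r}"
  have g: "(g has_real_derivative g' q) (at q)" for q
    unfolding g_def g'_def by (auto intro!: derivative_eq_intros)
  have g': "(g' has_real_derivative g'' q) (at q)" for q
    unfolding g'_def g''_def by (auto intro!: derivative_eq_intros)
  have cont: "continuous_on UNIV g''" unfolding g''_def by (intro continuous_intros)
  \<comment> \<open>Used twice: \<open>\<rho> < R\<close> keeps \<open>K\<close> at positive height,
    hence inside \<open>\<Omega>\<close>, and a height of at most \<open>R / 2\<close> forces
    distance at least \<open>R / 2\<close> from \<open>c\<close>.\<close>
  have height: "R - norm (z - c) \<le> snd z" for z
    using norm_snd_le[of "snd z - R" "fst z"] by (cases z) (simp add: c_def)
  have K_pos: "0 < snd z" if "z \<in> K" for z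
    using height[of z] that \<rho> by (simp add: K_def dist_norm norm_minus_commute)
  have K_ball: "z \<in> cball (0, R) R" if "z \<in> K" for z
    using that \<rho> by (simp add: K_def c_def)
  have K_sub: "K \<subseteq> \<Omega>"
  proof
    fix z assume zK: "z \<in> K"
    then show "z \<in> \<Omega>"
      using sub[of "fst z" "snd z"] K_pos[OF zK] K_ball[OF zK] by (simp add: K_def)
  qed
  have "closed {z :: 'a \<times> real. snd z \<le> r}"
    by (intro closed_Collect_le continuous_intros)
  then have "compact K" unfolding K_def by (intro compact_Int_closed) auto
  moreover have "K \<noteq> {}" using z by (auto simp: K_def c_def)
  moreover have "continuous_on K \<phi>"
    unfolding \<phi>_def g_def by (intro continuous_intros)
  then have "lsc_on K (\<lambda>z. u z - \<phi> z)"
    by (rule lsc_on_diff_continuous[OF lsc_on_subset[OF u(1) K_sub]])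
  ultimately obtain z0 where z0: "z0 \<in> K" "\<And>z. z \<in> K \<Longrightarrow> u z0 - \<phi> z0 \<le> u z - \<phi> z"
    by (rule lsc_on_attains_inf) blast
  have "u z - \<phi> z < 0"
    using neg by (simp add: \<phi>_def g_def c_def power2_norm_eq_inner)
  moreover have "z \<in> K" using z by (simp add: K_def c_def)
  ultimately have lt: "u z0 < \<phi> z0" using z0(2) by fastforce
  have "norm (z0 - c) < \<rho>"
  proof (rule ccontr)
    assume "\<not> ?thesis"
    then have "\<rho>\<^sup>2 \<le> (norm (z0 - c))\<^sup>2" using \<rho> by (intro power_mono) auto
    then have "\<phi> z0 \<le> 0"
      using m s by (simp add: \<phi>_def g_def power2_norm_eq_inner mult_le_0_iff)
    then show False using lt u(2)[of z0] z0(1) K_sub by auto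
  qed
  moreover have "snd z0 < r"
  proof (rule ccontr)
    assume "\<not> ?thesis"
    then have "z0 = (fst z0, r)" using z0(1) by (auto simp: K_def prod_eq_iff)
    then have "m \<le> u z0" using m(2) K_ball[OF z0(1)] by metis
    moreover have "\<phi> z0 \<le> m" using m(1) by (simp add: \<phi>_def g_def)
    ultimately show False using lt by simp
  qed
  ultimately have "z0 \<in> ball c \<rho> \<inter> {z. snd z < r}"
    by (simp add: dist_norm norm_minus_commute)
  moreover have "open (ball c \<rho> \<inter> {z. snd z < r})"
    by (intro open_Int open_Collect_less continuous_intros) auto
  ultimately have "\<forall>\<^sub>F z in at z0 within \<Omega>. z \<in> ball c \<rho> \<inter> {z. snd z < r}"
    by (metis eventually_at_topological)
  then have "\<forall>\<^sub>F z in at z0 within \<Omega>. u z0 - \<phi> z0 \<le> u z - \<phi> z"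
    by eventually_elim (auto simp: K_def intro!: z0(2))
  moreover have "C2_on UNIV \<phi>"
    unfolding \<phi>_def using g g' cont by (rule C2_on_radial)
  ultimately have "truncated_Pucci_sup k (hess \<phi> z0) + b * norm (grad \<phi> z0) \<le> 0"
    using u(3) z0(1) K_sub unfolding viscosity_supersolution_def by blast
  moreover have "truncated_Pucci_sup k (hess \<phi> z0) + b * norm (grad \<phi> z0) > 0"
    unfolding \<phi>_def
  proof (rule Pucci_radial_pos[OF g g' _ _ k(1)])
    show "g' ((z0 - c) \<bullet> (z0 - c)) < 0" "g'' ((z0 - c) \<bullet> (z0 - c)) < 0"
      using m s by (auto simp: g'_def g''_def)
    have "R / 2 \<le> norm (z0 - c)" using height[of z0] z0(1) r by (simp add: K_def)
    then show "k < b * norm (z0 - c)" using k by (smt (verit) mult_left_mono)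
  qed
  ultimately show False by simp
qed

theorem theorem14:
  fixes \<Omega> :: "((real ^ 'n) \<times> real) set" and k :: nat and b :: real
  assumes "1 \<le> k" and "k < DIM((real ^ 'n) \<times> real)"
    and "open \<Omega>" and "connected \<Omega>" and "\<Omega> \<noteq> {}"
    and "bounded \<Omega>" and "convex \<Omega>"
    and "\<Omega> \<subseteq> {(x, y). y > 0}"
    and "(0, 0) \<in> frontier \<Omega>"
    and "(\<lambda>(x, y). y) \<in> o[at (0, 0) within frontier \<Omega>](\<lambda>(x, y). (norm x)\<^sup>2)"
    and "b > 0"
  shows "\<not> (\<exists>u :: (real ^ 'n) \<times> real \<Rightarrow> real.
            lsc_on \<Omega> u \<and> (\<forall>z\<in>\<Omega>. u z > 0) \<and>
            viscosity_supersolution k b \<Omega> u \<and>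
            (u \<longlongrightarrow> 0) (at (0, 0) within \<Omega>))"
proof
  assume "\<exists>u :: (real ^ 'n) \<times> real \<Rightarrow> real.
            lsc_on \<Omega> u \<and> (\<forall>z\<in>\<Omega>. u z > 0) \<and>
            viscosity_supersolution k b \<Omega> u \<and>
            (u \<longlongrightarrow> 0) (at (0, 0) within \<Omega>)"
  then obtain u :: "(real ^ 'n) \<times> real \<Rightarrow> real" where lsc: "lsc_on \<Omega> u"
    and upos: "\<And>z. z \<in> \<Omega> \<Longrightarrow> u z > 0" and visc: "viscosity_supersolution k b \<Omega> u"
    and lim: "(u \<longlongrightarrow> 0) (at (0, 0) within \<Omega>)" by blast
  \<comment> \<open>This choice gives \<open>b * (R / 2) = k + 1\<close>, so
    \<open>b * norm (z - c)\<close> exceeds \<open>k\<close> wherever the distance from the centre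
    is at least \<open>R / 2\<close>.\<close>
  define R where "R = 2 * (real k + 1) / b"
  have R: "R > 0" "k < b * (R / 2)" using \<open>b > 0\<close> by (auto simp: R_def)
  obtain r where r: "0 < r" "r \<le> R / 2"
    and sub: "\<And>x y. (x, y) \<in> cball (0, R) R \<Longrightarrow> 0 < y \<Longrightarrow> y \<le> r \<Longrightarrow> (x, y) \<in> \<Omega>"
    using interior_ball_near_flat_point[OF assms(3,5,7-10) R(1)] by blast
  define T where "T = cball ((0, R) :: (real ^ 'n) \<times> real) R \<inter> {z. snd z = r}"
  have "closed {z :: (real ^ 'n) \<times> real. snd z = r}"
    by (intro closed_Collect_eq continuous_intros)
  then have "compact T" unfolding T_def by (intro compact_Int_closed) auto
  moreover have "(0, r) \<in> T"
    using r by (simp add: T_def dist_norm norm_Pair)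
  then have "T \<noteq> {}" by blast
  moreover have T_sub: "T \<subseteq> \<Omega>" using sub r by (auto simp: T_def)
  then have "lsc_on T u" using lsc lsc_on_subset by blast
  ultimately obtain zm where zm: "zm \<in> T" "\<And>z. z \<in> T \<Longrightarrow> u zm \<le> u z"
    by (rule lsc_on_attains_inf) blast
  define m where "m = u zm"
  have "0 < m" unfolding m_def using zm(1) T_sub upos by blast
  moreover have "m \<le> u (x, r)" if "(x, r) \<in> cball (0, R) R" for x
    unfolding m_def using that by (intro zm(2)) (simp add: T_def)
  ultimately have m: "0 < m" "\<And>x. (x, r) \<in> cball (0, R) R \<Longrightarrow> m \<le> u (x, r)" by auto
  \<comment> \<open>The bound \<open>m\<close> comes from the cap at height \<open>r\<close> alone,
    so it stays fixed while \<open>\<rho>\<close> and \<open>s\<close> depend on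
    \<open>t\<close>.\<close>
  have axis: "m / 2 \<le> u (0, t)" if t: "0 < t" "t \<le> r" for t
  proof -
    \<comment> \<open>Any radius strictly between \<open>R - t\<close>, the distance from
      \<open>(0, t)\<close> to the centre, and \<open>R\<close> would do.\<close>
    define \<rho> where "\<rho> = R - t / 2"
    have \<rho>: "0 < \<rho>" "\<rho> < R" using t r by (auto simp: \<rho>_def)
    have nt: "norm ((0, t) - (0, R) :: (real ^ 'n) \<times> real) = R - t"
      using t r by (simp add: norm_Pair)
    have gap: "(R - t)\<^sup>2 < \<rho>\<^sup>2" using t r by (intro power_strict_mono) (auto simp: \<rho>_def)
    \<comment> \<open>Chosen so that the exponential equals 1/2 at \<open>(0, t)\<close>. It may
      blow up as \<open>t\<close> tends to 0, which is harmless.\<close>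
    define s where "s = ln 2 / (\<rho>\<^sup>2 - (R - t)\<^sup>2)"
    have "s > 0" using gap by (simp add: s_def)
    have "s * ((R - t)\<^sup>2 - \<rho>\<^sup>2) = - ln 2" using gap by (simp add: s_def field_simps)
    then have half: "exp (s * ((R - t)\<^sup>2 - \<rho>\<^sup>2)) = 1 / 2" by (simp add: exp_minus)
    have "(0, t) \<in> cball ((0, R) :: (real ^ 'n) \<times> real) \<rho>"
      using nt t by (simp add: dist_norm norm_minus_commute \<rho>_def)
    then have "m * (1 - exp (s * ((norm ((0, t) - (0, R) :: (real ^ 'n) \<times> real))\<^sup>2 - \<rho>\<^sup>2)))
        \<le> u (0, t)"
      using t by (intro supersolution_ge_barrier[OF lsc upos visc assms(2) \<open>b > 0\<close> R(2) r sub m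
          \<open>s > 0\<close> \<rho>]) auto
    then show ?thesis unfolding nt half by simp
  qed
  have "\<forall>\<^sub>F z in at (0, 0) within \<Omega>. u z < m / 2"
    using lim m(1) by (intro order_tendstoD(2)[of u 0]) auto
  then obtain d where d: "d > 0"
    and small: "\<And>z. z \<in> \<Omega> \<Longrightarrow> z \<noteq> (0, 0) \<Longrightarrow> dist z (0, 0) < d \<Longrightarrow> u z < m / 2"
    unfolding eventually_at by blast
  \<comment> \<open>The point \<open>(0, t)\<close> is low enough for the axis bound and close
    enough to the origin for the limit to force \<open>u < m / 2\<close>.\<close>
  define t where "t = min r (d / 2)"
  have t: "0 < t" "t \<le> r" "t < d" using r d by (auto simp: t_def)
  have "(0, t) \<in> cball ((0, R) :: (real ^ 'n) \<times> real) R"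
    using t r by (simp add: dist_norm norm_Pair)
  then have "u (0, t) < m / 2"
    using t sub by (intro small) (auto simp: dist_norm norm_Pair)
  with axis[OF t(1,2)] show False by simp
qed

end
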